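(* Let $q$ be a positive integer relatively prime to $10$, and let $\omega_q\in\mathbb{Z}$ be its signed weight (defined in the context). For an integer $a$ with decimal digits $a_n a_{n-1}\ldots a_1 a_0$, write $a = 10\,\bar a + a_0$. If $T_q(a) = \bar a + \omega_q\, a_0$ is a trimming test for $q$, then $$S_q(a) := \sum_{j=0}^{n} \omega_q^{\,j}\, a_{n-j}$$ is a summing test for $q$. In particular, being a summing test means that $q \mid a$ if and only if $q\mid S_q(a)$ for every such $a$.
   Context: Decimal notation: an integer is written $a = a_n a_{n-1}\ldots a_1 a_0 = \sum_{k=0}^n 10^k a_k$ with each digit satisfying $0\le a_k\le 9$. Its length is the number of digits, $n+1$. Its last digit is $a_0$, and $\bar a := \sum_{k=1}^n 10^{k-1}a_k$, so that $a = 10\bar a + a_0$. Digit expressions are evaluated on the nonnegative integers $a$ written in this way; $n$ depends on $a$. The length of a negative integer is the number of digits of its absolute value. Divisibility test: a divisibility test for $q$ is an integer-valued function $f_q$ such that, for every $a$, $q$ divides $a$ if and only if $q$ divides $f_q(a)$. Trimming test: a divisibility test $f_q$ is a trimming test if the length of $f_q(a)$ is one less than the length of $a$ for almost every $a$ (that is, for all $a$ outside a set of natural density zero). Summing test: a divisibility test $f_q$ is a summing test for $q$ if it has the form $f_q(a) = \sum_{j=0}^n \gamma_j a_{n-j}$ with each $\gamma_j\in\mathbb{Z}$. Signed weight: let $q_0$ be the last decimal digit of $q$, and let $[x]$ denote the nearest integer to $x$. If $q_0=1$, then $\omega_q := -[q/10]$. If $q_0=9$, then $\omega_q := [q/10]$.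 If $q_0\in\{3,7\}$, then $\omega_q := \omega_{3q}$ (note that $3q$ ends in $9$ or $1$ respectively). *)

theory Defs
  imports Complex_Main "HOL-Library.Log_Nat"
begin

section \<open>Decimal notation\<close>

text \<open>
  Digits are those of the usual decimal expansion without leading zeros; the number \<open>0\<close> is
  written with the single digit \<open>0\<close>. So \<open>top_index a\<close> is the \<open>n\<close> in
  \<open>a = a\<^sub>n \<dots> a\<^sub>1 a\<^sub>0\<close>. The case distinction is needed because \<open>floorlog 10 0 = 0\<close>.
\<close>

definition digit :: "nat \<Rightarrow> nat \<Rightarrow> nat" where
  "digit a k = a div 10 ^ k mod 10"

definition dec_length :: "nat \<Rightarrow> nat" where
  "dec_length a = (if a = 0 then 1 else floorlog 10 a)"

definition int_length :: "int \<Rightarrow> nat" where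
  "int_length z = dec_length (nat \<bar>z\<bar>)"

definition top_index :: "nat \<Rightarrow> nat" where
  "top_index a = dec_length a - 1"

definition trim_last :: "nat \<Rightarrow> nat" where
  "trim_last a = (\<Sum>k = 1..top_index a. 10 ^ (k - 1) * digit a k)"

lemma digit_le_9: "digit a k \<le> 9"
  using mod_less_divisor[of 10 "a div 10 ^ k"] by (simp add: digit_def)

lemma dec_length_eq_Suc_top_index: "dec_length a = Suc (top_index a)"
  unfolding top_index_def dec_length_def
  by (auto simp: floorlog_def)

lemma less_power_dec_length: "a < 10 ^ dec_length a"
  using floorlog_bounds[of a 10] by (cases "a = 0") (auto simp: dec_length_def)

lemma power_top_index_le: "a > 0 \<Longrightarrow> 10 ^ top_index a \<le> a"
  using floorlog_bounds[of a 10] by (auto simp: dec_length_def top_index_def)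

lemma sum_digits_lessThan: "(\<Sum>k<m. 10 ^ k * digit a k) = a mod 10 ^ m"
proof (induction m)
  case (Suc m)
  have "a mod 10 ^ Suc m = a mod (10 ^ m * 10)"
    by (simp add: mult.commute)
  also have "\<dots> = 10 ^ m * (a div 10 ^ m mod 10) + a mod 10 ^ m"
    by (rule mod_mult2_eq)
  finally show ?case
    using Suc by (simp add: digit_def)
qed simp

theorem decimal_expansion: "a = (\<Sum>k = 0..top_index a. 10 ^ k * digit a k)"
proof -
  have "(\<Sum>k = 0..top_index a. 10 ^ k * digit a k) = (\<Sum>k<dec_length a. 10 ^ k * digit a k)"
    by (rule sum.cong) (auto simp: dec_length_eq_Suc_top_index)
  also have "\<dots> = a"
    using less_power_dec_length by (simp add: sum_digits_lessThan)
  finally show ?thesis ..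
qed

lemma trim_last_decomp: "a = 10 * trim_last a + digit a 0"
proof -
  have "(\<Sum>k = 0..top_index a. 10 ^ k * digit a k)
      = digit a 0 + (\<Sum>k = 1..top_index a. 10 ^ k * digit a k)"
    by (simp add: sum.atLeast_Suc_atMost)
  also have "(\<Sum>k = 1..top_index a. 10 ^ k * digit a k) = 10 * trim_last a"
    unfolding trim_last_def sum_distrib_left
    by (rule sum.cong) (auto simp: power_eq_if)
  finally show ?thesis
    using decimal_expansion[of a] by simp
qed

section \<open>Divisibility tests\<close>

definition natural_density_zero :: "nat set \<Rightarrow> bool" where
  "natural_density_zero A \<longleftrightarrow>
     (\<lambda>N. real (card (A \<inter> {1..N})) / real N) \<longlonglongrightarrow> 0"

definition divisibility_test :: "nat \<Rightarrow> (nat \<Rightarrow> int) \<Rightarrow> bool" where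
  "divisibility_test q f \<longleftrightarrow> (\<forall>a. q dvd a \<longleftrightarrow> int q dvd f a)"

definition trimming_test :: "nat \<Rightarrow> (nat \<Rightarrow> int) \<Rightarrow> bool" where
  "trimming_test q f \<longleftrightarrow> divisibility_test q f \<and>
     natural_density_zero {a. int_length (f a) + 1 \<noteq> dec_length a}"

text \<open>The coefficients \<open>\<gamma>\<close> form one sequence that does not depend on \<open>a\<close>.\<close>

definition summing_test :: "nat \<Rightarrow> (nat \<Rightarrow> int) \<Rightarrow> bool" where
  "summing_test q f \<longleftrightarrow> divisibility_test q f \<and>
     (\<exists>\<gamma> :: nat \<Rightarrow> int. \<forall>a. f a = (\<Sum>j = 0..top_index a. \<gamma> j * int (digit a (top_index a - j))))"

section \<open>The signed weight\<close>

text \<open>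
  The value \<open>0\<close> in the last case is a dummy: it is reached only when \<open>q\<close> is not coprime to \<open>10\<close>.
  The library function \<open>round\<close> rounds ties upwards, but no tie occurs for last digits 1 and 9.
\<close>

function signed_weight :: "nat \<Rightarrow> int" where
  "signed_weight q =
     (if digit q 0 = 1 then - round (real q / 10)
      else if digit q 0 = 9 then round (real q / 10)
      else if digit q 0 \<in> {3, 7} then signed_weight (3 * q)
      else 0)"
  by pat_completeness auto
termination
proof (relation "measure (\<lambda>q. if digit q 0 \<in> {3, 7} then 1 else 0)")
  fix q :: nat
  assume "digit q 0 \<in> {3, 7}"
  moreover have "digit (3 * q) 0 = 3 * digit q 0 mod 10"
    by (simp add: digit_def mod_mult_right_eq)
  ultimately show "(3 * q, q) \<in> measure (\<lambda>q. if digit q 0 \<in> {3, 7} then 1 else 0)"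
    by auto
qed simp

declare signed_weight.simps [simp del]

definition trim_map :: "nat \<Rightarrow> nat \<Rightarrow> int" where
  "trim_map q a = int (trim_last a) + signed_weight q * int (digit a 0)"

definition sum_map :: "nat \<Rightarrow> nat \<Rightarrow> int" where
  "sum_map q a = (\<Sum>j = 0..top_index a. signed_weight q ^ j * int (digit a (top_index a - j)))"

end

theory Submission
  imports Defs "HOL-Number_Theory.Cong"
begin

text \<open>
  The weight acts as an inverse of \<open>10\<close> modulo \<open>q\<close>: since
  \<open>10 (trim_last a + w a\<^sub>0) = a + (10 w - 1) a\<^sub>0\<close>, a divisibility test of this shape, applied to a
  multiple of \<open>q\<close> whose last digit is \<open>1\<close>, forces \<open>q\<close> to divide \<open>10 w - 1\<close>
  (lemma \<open>weight_cong_inverse_10\<close>). Such a multiple exists because \<open>q\<close> is invertible modulo \<open>10\<close>.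
  As \<open>10 w\<close> is congruent to \<open>1\<close>, multiplying the sum of the \<open>w\<^sup>j a\<^bsub>n-j\<^esub>\<close> by \<open>10\<^sup>n\<close> turns each
  weight \<open>w\<^sup>j\<close> into the decimal place value \<open>10\<^bsup>n-j\<^esup>\<close>, which gives back \<open>a\<close> modulo \<open>q\<close>
  (lemma \<open>power_10_weighted_digit_sum_cong\<close>). The factor \<open>10\<^sup>n\<close> is coprime to \<open>q\<close>, so \<open>q\<close> divides
  the weighted sum exactly when it divides \<open>a\<close>.
\<close>

lemma weight_cong_inverse_10:
  fixes w :: int
  assumes "coprime q 10"
    and test: "divisibility_test q (\<lambda>a. int (trim_last a) + w * int (digit a 0))"
  shows "[10 * w = 1] (mod int q)"
proof -
  obtain x where "[q * x = 1] (mod 10)"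
    using cong_solve_coprime_nat[OF assms(1)] by auto
  then have last: "digit (q * x) 0 = 1"
    by (simp add: digit_def cong_def)
  have "int q dvd int (trim_last (q * x)) + w"
    using test last unfolding divisibility_test_def
    by (metis dvd_triv_left mult.right_neutral of_nat_1)
  moreover have "int q dvd 10 * int (trim_last (q * x)) + 1"
  proof -
    have "q * x = 10 * trim_last (q * x) + 1"
      using trim_last_decomp[of "q * x"] last by simp
    then have "int q * int x = 10 * int (trim_last (q * x)) + 1"
      by (metis of_nat_1 of_nat_add of_nat_mult of_nat_numeral)
    then show ?thesis
      by (metis dvd_triv_left)
  qed
  ultimately have "int q dvd 10 * (int (trim_last (q * x)) + w) - (10 * int (trim_last (q * x)) + 1)"
    by (intro dvd_diff dvd_mult)
  then show ?thesis
    by (simp add: cong_iff_dvd_diff)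
qed

text \<open>
  Termwise, \<open>b\<^sup>n w\<^sup>j = b\<^bsup>n-j\<^esup> (b w)\<^sup>j\<close>, and the last factor is congruent to \<open>1\<close>: weights counted
  from the leading digit become place values counted from the last digit.
\<close>

lemma power_base_weighted_sum_cong:
  fixes b w m :: int and d :: "nat \<Rightarrow> int"
  assumes "[b * w = 1] (mod m)"
  shows "[b ^ n * (\<Sum>j = 0..n. w ^ j * d (n - j)) = (\<Sum>k = 0..n. b ^ k * d k)] (mod m)"
proof -
  have "[b ^ n * (w ^ j * d (n - j)) = b ^ (n - j) * d (n - j)] (mod m)" if "j \<in> {0..n}" for j
  proof -
    have "b ^ n = b ^ (n - j) * b ^ j"
      using that by (simp flip: power_add)
    then have eq: "b ^ n * (w ^ j * d (n - j)) = b ^ (n - j) * d (n - j) * (b * w) ^ j"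
      by (simp add: power_mult_distrib mult_ac)
    have "[(b * w) ^ j = 1] (mod m)"
      using cong_pow[OF assms, of j] by simp
    from cong_scalar_left[OF this, of "b ^ (n - j) * d (n - j)"] show ?thesis
      unfolding eq by simp
  qed
  then have "[b ^ n * (\<Sum>j = 0..n. w ^ j * d (n - j)) = (\<Sum>j = 0..n. b ^ (n - j) * d (n - j))] (mod m)"
    unfolding sum_distrib_left by (rule cong_sum)
  also have "(\<Sum>j = 0..n. b ^ (n - j) * d (n - j)) = (\<Sum>k = 0..n. b ^ k * d k)"
    by (rule sum.reindex_bij_witness[of _ "\<lambda>k. n - k" "\<lambda>k. n - k"]) auto
  finally show ?thesis .
qed

lemma power_10_weighted_digit_sum_cong:
  fixes w m :: int
  assumes "[10 * w = 1] (mod m)"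
  shows "[10 ^ top_index a * (\<Sum>j = 0..top_index a. w ^ j * int (digit a (top_index a - j))) = int a] (mod m)"
proof -
  have "int a = (\<Sum>k = 0..top_index a. 10 ^ k * int (digit a k))"
    by (subst (1) decimal_expansion) simp
  then show ?thesis
    using power_base_weighted_sum_cong[OF assms, of "top_index a" "\<lambda>k. int (digit a k)"] by simp
qed

lemma divisibility_test_weighted_digit_sum:
  fixes w :: int
  assumes "coprime q 10" and "[10 * w = 1] (mod int q)"
  shows "divisibility_test q (\<lambda>a. \<Sum>j = 0..top_index a. w ^ j * int (digit a (top_index a - j)))"
  unfolding divisibility_test_def
proof
  fix a
  let ?S = "\<Sum>j = 0..top_index a. w ^ j * int (digit a (top_index a - j))"
  have "coprime (int q) (10 ^ top_index a)"
    using assms(1) by (metis coprime_int_iff coprime_power_right_iff of_nat_numeral)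
  then have "int q dvd ?S \<longleftrightarrow> int q dvd 10 ^ top_index a * ?S"
    by (simp add: coprime_dvd_mult_right_iff)
  also have "\<dots> \<longleftrightarrow> int q dvd int a"
    by (rule cong_dvd_iff) (rule power_10_weighted_digit_sum_cong[OF assms(2)])
  finally show "q dvd a \<longleftrightarrow> int q dvd ?S"
    by simp
qed

theorem theorem2:
  fixes q :: nat
  assumes "q > 0" and "coprime q 10"
    and "trimming_test q (trim_map q)"
  shows "summing_test q (sum_map q) \<and> (\<forall>a :: nat. q dvd a \<longleftrightarrow> int q dvd sum_map q a)"
proof -
  have "divisibility_test q (\<lambda>a. int (trim_last a) + signed_weight q * int (digit a 0))"
    using assms(3) by (simp add: trimming_test_def trim_map_def[abs_def])
  then have "[10 * signed_weight q = 1] (mod int q)"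
    by (rule weight_cong_inverse_10[OF assms(2)])
  then have test: "divisibility_test q (sum_map q)"
    unfolding sum_map_def[abs_def] by (rule divisibility_test_weighted_digit_sum[OF assms(2)])
  moreover have "\<forall>a. sum_map q a
      = (\<Sum>j = 0..top_index a. signed_weight q ^ j * int (digit a (top_index a - j)))"
    by (simp add: sum_map_def)
  ultimately have "summing_test q (sum_map q)"
    unfolding summing_test_def by (intro conjI exI[of _ "\<lambda>j. signed_weight q ^ j"]) simp_all
  with test show ?thesis
    by (simp add: divisibility_test_def)
qed

end
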